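(* Let $(S,\Sigma,\mu)$ be a measure space, with $\mu$ a complete positive measure, that has two disjoint measurable sets of finite positive measure, and let $X$ be a non-zero Banach space over $\mathbb{F}$ ($\mathbb{R}$ or $\mathbb{C}$) whose norm is Fréchet differentiable. Then, for $1<p<\infty$, $L^p(\mu,X)$ does not have Property P.
   Context: $L^p(\mu,X)$ is the Lebesgue-Bochner space of (a.e.-equivalence classes of) strongly measurable functions $f:S\to X$ (a.e. pointwise limits of simple measurable functions) with $\|f\|=\left(\int_S\|f(s)\|^p\,d\mu(s)\right)^{1/p}<\infty$. The norm of $X$ is Fréchet differentiable if for every non-zero $x\in X$ there is $\phi\in X^*$ with $\lim_{h\to0}\frac{\left|\|x+h\|-\|x\|-\operatorname{Re}\phi(h)\right|}{\|h\|}=0$ (with $\operatorname{Re}\phi=\phi$ if $\mathbb{F}=\mathbb{R}$). Let $Y$ be a normed space over $\mathbb{F}$. For $x,y\in Y$, $x$ is Birkhoff-James orthogonal to $y$, written $x\perp_{BJ}y$, if $\|x+\alpha y\|\ge\|x\|$ for all $\alpha\in\mathbb{F}$. For $\epsilon\in(0,1)$, $x$ is $\epsilon$-approximate Birkhoff-James orthogonal to $y$, written $x\perp^{\epsilon}_{BJ}y$, if $\|x+\alpha y\|^2\ge\|x\|^2-2\epsilon\|x\|\|\alpha y\|$ for all $\alpha\in\mathbb{F}$. A Banach space $Y$ over $\mathbb{F}$ has Property P if there exists $\epsilon\in(0,1)$ such that every bounded linear operator $T:Y\to Y$ satisfying "for all $x,y\in Y$, $x\perp_{BJ}y$ implies $T(x)\perp^{\epsilon}_{BJ}T(y)$"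 is a scalar multiple of an isometry (that is, there is $c\ge 0$ with $\|T(x)\|=c\|x\|$ for all $x\in Y$). *)

theory Defs
  imports "HOL-Analysis.Analysis"
begin

section \<open>Normed spaces over a scalar field\<close>

text \<open>
  The scalar field is a type \<open>'k\<close>, to be instantiated by \<^typ>\<open>real\<close> or \<^typ>\<open>complex\<close>. The library
  only provides real normed spaces, so a complex normed space is a type of class
  \<^class>\<open>real_normed_vector\<close> together with a scalar multiplication that extends the
  real one and is compatible with the norm.
\<close>

locale normed_space_over = vector_space smul
  for smul :: "'k::real_normed_field \<Rightarrow> 'x::real_normed_vector \<Rightarrow> 'x" +
  assumes scale_of_real: "smul (of_real r) x = r *\<^sub>R x"
    and norm_scale: "norm (smul a x) = norm a * norm x"

definition dual_space ::
    "('k::real_normed_field \<Rightarrow> 'x::real_normed_vector \<Rightarrow> 'x) \<Rightarrow> ('x \<Rightarrow> 'k) set" where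
  "dual_space smul =
     {\<phi>. Vector_Spaces.linear smul (*) \<phi> \<and> (\<exists>K. \<forall>x. norm (\<phi> x) \<le> K * norm x)}"

text \<open>The argument \<open>re\<close> is the real part on the scalar field: \<^term>\<open>id\<close> or \<^term>\<open>Re\<close>.\<close>

definition frechet_differentiable_norm ::
    "('k::real_normed_field \<Rightarrow> 'x::real_normed_vector \<Rightarrow> 'x) \<Rightarrow> ('k \<Rightarrow> real) \<Rightarrow> bool" where
  "frechet_differentiable_norm smul re \<longleftrightarrow>
     (\<forall>x. x \<noteq> 0 \<longrightarrow>
       (\<exists>\<phi>\<in>dual_space smul.
         ((\<lambda>h. \<bar>norm (x + h) - norm x - re (\<phi> h)\<bar> / norm h) \<longlongrightarrow> 0) (at 0)))"

text \<open>
  The space \<open>L\<^sup>p(\<mu>,X)\<close> depends on the value \<open>\<mu>\<close> and hence is not a type; normed spaces are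
  therefore also treated as structures with an explicit carrier set.
\<close>

record ('k, 'v) normed_structure =
  points :: "'v set"
  vadd :: "'v \<Rightarrow> 'v \<Rightarrow> 'v"
  vscale :: "'k \<Rightarrow> 'v \<Rightarrow> 'v"
  vnorm :: "'v \<Rightarrow> real"

definition BJ_orthogonal :: "('k, 'v) normed_structure \<Rightarrow> 'v \<Rightarrow> 'v \<Rightarrow> bool" where
  "BJ_orthogonal Y x y \<longleftrightarrow> (\<forall>\<alpha>. vnorm Y (vadd Y x (vscale Y \<alpha> y)) \<ge> vnorm Y x)"

definition approx_BJ_orthogonal ::
    "('k, 'v) normed_structure \<Rightarrow> real \<Rightarrow> 'v \<Rightarrow> 'v \<Rightarrow> bool" where
  "approx_BJ_orthogonal Y \<epsilon> x y \<longleftrightarrow>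
     (\<forall>\<alpha>. (vnorm Y (vadd Y x (vscale Y \<alpha> y)))\<^sup>2
            \<ge> (vnorm Y x)\<^sup>2 - 2 * \<epsilon> * vnorm Y x * vnorm Y (vscale Y \<alpha> y))"

definition bounded_operators :: "('k, 'v) normed_structure \<Rightarrow> ('v \<Rightarrow> 'v) set" where
  "bounded_operators Y =
     {T. (\<forall>x\<in>points Y. T x \<in> points Y) \<and>
         (\<forall>x\<in>points Y. \<forall>y\<in>points Y. T (vadd Y x y) = vadd Y (T x) (T y)) \<and>
         (\<forall>a. \<forall>x\<in>points Y. T (vscale Y a x) = vscale Y a (T x)) \<and>
         (\<exists>K. \<forall>x\<in>points Y. vnorm Y (T x) \<le> K * vnorm Y x)}"

definition property_P :: "('k, 'v) normed_structure \<Rightarrow> bool" where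
  "property_P Y \<longleftrightarrow>
     (\<exists>\<epsilon>. 0 < \<epsilon> \<and> \<epsilon> < 1 \<and>
       (\<forall>T\<in>bounded_operators Y.
         (\<forall>x\<in>points Y. \<forall>y\<in>points Y.
            BJ_orthogonal Y x y \<longrightarrow> approx_BJ_orthogonal Y \<epsilon> (T x) (T y)) \<longrightarrow>
         (\<exists>c\<ge>0. \<forall>x\<in>points Y. vnorm Y (T x) = c * vnorm Y x)))"


section \<open>Lebesgue-Bochner spaces\<close>

text \<open>
  The space \<open>X\<close> need not be separable, so strong measurability can be strictly stronger than Borel
  measurability.
\<close>

definition strongly_measurable :: "'s measure \<Rightarrow> ('s \<Rightarrow> 'x::real_normed_vector) \<Rightarrow> bool" where
  "strongly_measurable M f \<longleftrightarrow>
     (\<exists>u. (\<forall>i::nat. simple_function M (u i)) \<and> (AE s in M. (\<lambda>i. u i s) \<longlonglongrightarrow> f s))"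

text \<open>
  For complete \<open>M\<close> and strongly measurable \<open>f\<close> the function \<open>s \<mapsto> \<parallel>f(s)\<parallel>\<^sup>p\<close> is measurable, so that
  integrability just says that its integral is finite.
\<close>

definition Lp_functions :: "'s measure \<Rightarrow> real \<Rightarrow> ('s \<Rightarrow> 'x::real_normed_vector) set" where
  "Lp_functions M p =
     {f. strongly_measurable M f \<and> integrable M (\<lambda>s. norm (f s) powr p)}"

definition Lp_function_norm :: "'s measure \<Rightarrow> real \<Rightarrow> ('s \<Rightarrow> 'x::real_normed_vector) \<Rightarrow> real" where
  "Lp_function_norm M p f = (\<integral>s. norm (f s) powr p \<partial>M) powr (1 / p)"

definition Lp_eq ::
    "'s measure \<Rightarrow> real \<Rightarrow> (('s \<Rightarrow> 'x::real_normed_vector) \<times> ('s \<Rightarrow> 'x)) set" where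
  "Lp_eq M p = {(f, g). f \<in> Lp_functions M p \<and> g \<in> Lp_functions M p \<and> (AE s in M. f s = g s)}"

text \<open>The points are a.e.-equivalence classes; the operations do not depend on representatives.\<close>

definition Lp_space ::
    "('k \<Rightarrow> 'x \<Rightarrow> 'x) \<Rightarrow> 's measure \<Rightarrow> real
       \<Rightarrow> ('k, ('s \<Rightarrow> 'x::real_normed_vector) set) normed_structure" where
  "Lp_space smul M p =
     \<lparr> points = Lp_functions M p // Lp_eq M p,
       vadd = (\<lambda>U V. {h \<in> Lp_functions M p. \<exists>f\<in>U. \<exists>g\<in>V. AE s in M. h s = f s + g s}),
       vscale = (\<lambda>a U. {h \<in> Lp_functions M p. \<exists>f\<in>U. AE s in M. h s = smul a (f s)}),
       vnorm = (\<lambda>U. the_elem (Lp_function_norm M p ` U)) \<rparr>"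

lemma equiv_Lp_eq: "equiv (Lp_functions M p) (Lp_eq M p)"
proof (rule equivI)
  show "Lp_eq M p \<subseteq> Lp_functions M p \<times> Lp_functions M p"
    by (auto simp: Lp_eq_def)
  show "refl_on (Lp_functions M p) (Lp_eq M p)"
    by (auto simp: refl_on_def Lp_eq_def)
  show "sym (Lp_eq M p)"
    by (auto simp: sym_def Lp_eq_def elim: AE_mp)
  show "trans (Lp_eq M p)"
    by (auto simp: trans_def Lp_eq_def)
qed

lemma Lp_space_vadd:
  assumes "f \<in> Lp_functions M p" "g \<in> Lp_functions M p" "(\<lambda>s. f s + g s) \<in> Lp_functions M p"
  shows "vadd (Lp_space smul M p) (Lp_eq M p `` {f}) (Lp_eq M p `` {g})
           = Lp_eq M p `` {\<lambda>s. f s + g s}"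
proof -
  have "AE s in M. f s + g s = h s"
    if "AE s in M. f s = f' s" "AE s in M. g s = g' s" "AE s in M. h s = f' s + g' s"
    for f' g' h
    using that by eventually_elim simp
  moreover have "AE s in M. h s = f s + g s" if "AE s in M. f s + g s = h s" for h
    using that by eventually_elim simp
  ultimately show ?thesis
    using assms by (auto simp: Lp_space_def Lp_eq_def Image_def) blast+
qed

lemma Lp_space_vscale:
  assumes "f \<in> Lp_functions M p" "(\<lambda>s. smul a (f s)) \<in> Lp_functions M p"
  shows "vscale (Lp_space smul M p) a (Lp_eq M p `` {f}) = Lp_eq M p `` {\<lambda>s. smul a (f s)}"
proof -
  have "AE s in M. smul a (f s) = h s"
    if "AE s in M. f s = f' s" "AE s in M. h s = smul a (f' s)" for f' h
    using that by eventually_elim simp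
  moreover have "AE s in M. h s = smul a (f s)" if "AE s in M. smul a (f s) = h s" for h
    using that by eventually_elim simp
  ultimately show ?thesis
    using assms by (auto simp: Lp_space_def Lp_eq_def Image_def)
qed

lemma Lp_space_vnorm:
  assumes "f \<in> Lp_functions M p"
  shows "vnorm (Lp_space smul M p) (Lp_eq M p `` {f}) = Lp_function_norm M p f"
proof -
  have "Lp_function_norm M p g = Lp_function_norm M p f" if "(f, g) \<in> Lp_eq M p" for g
  proof -
    have "(\<integral>s. norm (g s) powr p \<partial>M) = (\<integral>s. norm (f s) powr p \<partial>M)"
      using that
      by (intro integral_cong_AE borel_measurable_integrable)
        (auto simp: Lp_eq_def Lp_functions_def)
    then show ?thesis by (simp add: Lp_function_norm_def)
  qed
  moreover have "(f, f) \<in> Lp_eq M p"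
    using assms by (simp add: Lp_eq_def)
  ultimately have "Lp_function_norm M p ` (Lp_eq M p `` {f}) = {Lp_function_norm M p f}"
    by blast
  then show ?thesis by (simp add: Lp_space_def)
qed

end

theory Submission
  imports Defs
begin

text \<open>
  Write \<open>I(f) = \<integral> \<parallel>f\<parallel>\<^sup>p\<close>, let \<open>A\<close> and \<open>B\<close> be the two sets of finite positive measure, and fix
  \<open>\<epsilon> \<in> (0,1)\<close>. The operator that refutes Property P for \<open>\<epsilon>\<close> is \<open>T f = w f\<close>, where the weight
  \<open>w\<close> is a constant \<open>r\<close> on \<open>A\<close> and \<open>1\<close> elsewhere, with \<open>r\<^sup>p = 1 + \<epsilon>/p\<close>. It multiplies the norm of
  functions supported in \<open>A\<close> by \<open>r > 1\<close> and fixes functions supported in \<open>B\<close>, so it is not a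
  multiple of an isometry.

  It almost preserves orthogonality for the following reason. We have
  \<open>I(w f) = I(f) + (\<epsilon>/p) \<integral>\<^sub>A \<parallel>f\<parallel>\<^sup>p\<close>. If \<open>f\<close> is orthogonal to \<open>g\<close> and \<open>h = \<alpha> g\<close>, then passing from
  \<open>f\<close> to \<open>f + h\<close> does not decrease the first summand, and it decreases the second one by little:
  since \<open>t \<mapsto> t\<^sup>p\<close> lies above its tangents, \<open>\<parallel>f + h\<parallel>\<^sup>p \<ge> \<parallel>f\<parallel>\<^sup>p - p \<parallel>f\<parallel>\<^sup>p\<^sup>-\<^sup>1 \<parallel>h\<parallel>\<close> pointwise, and
  Hoelder's inequality bounds the integral of the last term. With \<open>N\<close>, \<open>a\<close>, \<open>b\<close> the norms of
  \<open>T (f + h)\<close>, \<open>T f\<close> and \<open>T h\<close> this gives \<open>N\<^sup>p \<ge> a\<^sup>p - \<epsilon> a\<^sup>p\<^sup>-\<^sup>1 b\<close>, hence \<open>N \<ge> a - \<epsilon> b\<close>, which is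
  stronger than \<open>\<epsilon>\<close>-approximate orthogonality of \<open>T f\<close> and \<open>T g\<close>.
\<close>

section \<open>Inequalities for powers\<close>

lemma Young_powr:
  fixes u v p :: real
  assumes "1 < p" "0 \<le> u" "0 \<le> v"
  shows "p * (u powr (p - 1) * v) \<le> (p - 1) * u powr p + v powr p"
proof -
  have "u powr (p - 1) * v \<le> (u powr (p - 1)) powr (p / (p - 1)) / (p / (p - 1)) + v powr p / p"
    using assms by (intro Youngs_inequality) (auto simp: field_simps)
  also have "(u powr (p - 1)) powr (p / (p - 1)) = u powr p"
    using assms by (simp add: powr_powr)
  finally show ?thesis
    using assms by (simp add: field_simps)
qed

text \<open>
  Young's inequality, read as the statement that the graph of \<open>t \<mapsto> t\<^sup>p\<close> lies above its tangent
  at \<open>x\<close>.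
\<close>

lemma powr_ge_tangent:
  fixes x y z p :: real
  assumes "1 < p" "0 \<le> x" "0 \<le> z" "x - y \<le> z"
  shows "x powr p - p * (x powr (p - 1) * y) \<le> z powr p"
proof -
  have "x powr (p - 1) * (x - y) \<le> x powr (p - 1) * z"
    using assms by (intro mult_left_mono) auto
  moreover have "x powr (p - 1) * x = x powr p"
    using powr_mult_base[of x "p - 1"] assms by (simp add: mult.commute)
  ultimately have "x powr p - x powr (p - 1) * y \<le> x powr (p - 1) * z"
    by (simp add: right_diff_distrib)
  then have "p * (x powr p - x powr (p - 1) * y) \<le> p * (x powr (p - 1) * z)"
    using assms by (intro mult_left_mono) auto
  then show ?thesis
    using Young_powr[of p x z] assms by (simp add: algebra_simps)
qed

lemma add_powr_le:
  fixes u v p :: real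
  assumes "0 < p" "0 \<le> u" "0 \<le> v"
  shows "(u + v) powr p \<le> 2 powr p * (u powr p + v powr p)"
proof -
  have "(u + v) powr p \<le> (2 * max u v) powr p"
    using assms by (intro powr_mono2) auto
  also have "\<dots> = 2 powr p * max u v powr p"
    using assms by (simp add: powr_mult)
  also have "\<dots> \<le> 2 powr p * (u powr p + v powr p)"
    by (intro mult_left_mono) (auto simp: max_def)
  finally show ?thesis .
qed

text \<open>
  If \<open>N < a - b\<close>, then \<open>N\<^sup>p < (a - b)\<^sup>p\<^sup>-\<^sup>1 (a - b) \<le> a\<^sup>p\<^sup>-\<^sup>1 (a - b)\<close>. This turns the estimate for
  integrals of \<open>p\<close>-th powers into one for norms without taking a root of the left-hand side.
\<close>

lemma ge_diff_if_powr_ge: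
  fixes N a b p :: real
  assumes "1 < p" "0 \<le> N" "0 \<le> a" "0 \<le> b"
    and le: "a powr p - a powr (p - 1) * b \<le> N powr p"
  shows "a - b \<le> N"
proof (rule ccontr)
  assume "\<not> a - b \<le> N"
  then have less: "N < a - b" by simp
  then have pos: "0 < a - b" "0 < a" using assms by auto
  have "N powr p < (a - b) powr p"
    using less assms by (intro powr_less_mono2) auto
  also have "\<dots> = (a - b) powr (p - 1) * (a - b)"
    using powr_mult_base[of "a - b" "p - 1"] pos by (simp add: mult.commute)
  also have "\<dots> \<le> a powr (p - 1) * (a - b)"
    using pos assms by (intro mult_right_mono powr_mono2) auto
  also have "\<dots> = a powr p - a powr (p - 1) * b"
    using powr_mult_base[of a "p - 1"] pos by (simp add: algebra_simps)
  finally show False using le by simp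
qed

text \<open>
  For \<open>b = \<epsilon> \<parallel>\<alpha> y\<parallel>\<close> this passes from a linear lower bound on the norm to the squared form in the
  definition of approximate orthogonality. If \<open>a < b\<close>, the left-hand side is not positive.
\<close>

lemma square_ge_if_ge_diff:
  fixes N a b :: real
  assumes "0 \<le> a" "0 \<le> b" "a - b \<le> N"
  shows "a\<^sup>2 - 2 * a * b \<le> N\<^sup>2"
proof (cases "b \<le> a")
  case True
  then have "(a - b)\<^sup>2 \<le> N\<^sup>2"
    using assms by (intro power_mono) auto
  moreover have "(a - b)\<^sup>2 = a\<^sup>2 - 2 * a * b + b\<^sup>2"
    by (simp add: power2_diff)
  moreover have "0 \<le> b\<^sup>2" by simp
  ultimately show ?thesis by linarith
next
  case False
  then have "a * (a - 2 * b) \<le> 0"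
    using assms by (intro mult_nonneg_nonpos) auto
  then have "a\<^sup>2 - 2 * a * b \<le> 0"
    by (simp add: power2_eq_square algebra_simps)
  moreover have "0 \<le> N\<^sup>2" by simp
  ultimately show ?thesis by linarith
qed

section \<open>Hoelder's inequality\<close>

lemma integrable_powr_mult:
  fixes u v :: "'s \<Rightarrow> real"
  assumes "1 < p" and nn: "\<And>s. 0 \<le> u s" "\<And>s. 0 \<le> v s"
    and [measurable]: "u \<in> borel_measurable M" "v \<in> borel_measurable M"
    and "integrable M (\<lambda>s. u s powr p)" "integrable M (\<lambda>s. v s powr p)"
  shows "integrable M (\<lambda>s. u s powr (p - 1) * v s)"
proof (rule Bochner_Integration.integrable_bound)
  show "integrable M (\<lambda>s. (p - 1) * u s powr p + v s powr p)"
    using assms by auto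
  have "u s powr (p - 1) * v s \<le> (p - 1) * u s powr p + v s powr p" for s
  proof -
    have "1 * (u s powr (p - 1) * v s) \<le> p * (u s powr (p - 1) * v s)"
      using assms by (intro mult_right_mono) auto
    then show ?thesis
      using Young_powr[of p "u s" "v s"] assms by simp
  qed
  then show "AE s in M. norm (u s powr (p - 1) * v s) \<le> norm ((p - 1) * u s powr p + v s powr p)"
    using assms by (auto simp: abs_mult)
qed measurable

text \<open>
  Integrate Young's inequality for \<open>u/a\<close> and \<open>v/b\<close>, where \<open>a\<close> and \<open>b\<close> are the \<open>p\<close>-norms of
  \<open>u\<close> and \<open>v\<close>. The exponent of \<open>u\<close> is already \<open>p - 1\<close>, the form in which the tangent
  inequality produces it.
\<close>

lemma Hoelder_powr:
  fixes u v :: "'s \<Rightarrow> real"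
  assumes p: "1 < p" and nn: "\<And>s. 0 \<le> u s" "\<And>s. 0 \<le> v s"
    and meas[measurable]: "u \<in> borel_measurable M" "v \<in> borel_measurable M"
    and int: "integrable M (\<lambda>s. u s powr p)" "integrable M (\<lambda>s. v s powr p)"
  defines "a \<equiv> (\<integral>s. u s powr p \<partial>M) powr (1 / p)"
    and "b \<equiv> (\<integral>s. v s powr p \<partial>M) powr (1 / p)"
  shows "(\<integral>s. u s powr (p - 1) * v s \<partial>M) \<le> a powr (p - 1) * b"
proof -
  have int_nn: "0 \<le> (\<integral>s. u s powr p \<partial>M)" "0 \<le> (\<integral>s. v s powr p \<partial>M)"
    by (auto intro!: integral_nonneg_AE)
  show ?thesis
  proof (cases "a = 0 \<or> b = 0")
    case True
    then have "(AE s in M. u s powr p = 0) \<or> (AE s in M. v s powr p = 0)"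
      using int by (auto simp: a_def b_def integral_nonneg_eq_0_iff_AE)
    then have "AE s in M. u s powr (p - 1) * v s = 0"
      by (elim disjE) (auto elim: AE_mp)
    then have "(\<integral>s. u s powr (p - 1) * v s \<partial>M) = 0"
      by (subst integral_cong_AE[of _ _ "\<lambda>_. 0"]) auto
    then show ?thesis by (simp add: b_def)
  next
    case False
    then have ab: "0 < a" "0 < b" by (auto simp: a_def b_def)
    have powr_p: "a powr p = (\<integral>s. u s powr p \<partial>M)" "b powr p = (\<integral>s. v s powr p \<partial>M)"
      using p int_nn by (auto simp: a_def b_def powr_powr)
    define C where "C = a powr (p - 1) * b"
    have C: "0 < C" using ab by (simp add: C_def)
    have pointwise: "p * (u s powr (p - 1) * v s)
        \<le> C * ((p - 1) * (u s powr p / a powr p) + v s powr p / b powr p)" for s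
    proof -
      have "p * (u s powr (p - 1) * v s) = C * (p * ((u s / a) powr (p - 1) * (v s / b)))"
        using ab nn by (simp add: C_def powr_divide)
      also have "\<dots> \<le> C * ((p - 1) * (u s / a) powr p + (v s / b) powr p)"
        using C p nn ab by (intro mult_left_mono Young_powr) auto
      finally show ?thesis using ab nn by (simp add: powr_divide)
    qed
    have "p * (\<integral>s. u s powr (p - 1) * v s \<partial>M) = (\<integral>s. p * (u s powr (p - 1) * v s) \<partial>M)"
      by simp
    also have "\<dots> \<le> (\<integral>s. C * ((p - 1) * (u s powr p / a powr p) + v s powr p / b powr p) \<partial>M)"
      using integrable_powr_mult[OF p nn meas int] int pointwise
      by (intro integral_mono) auto
    also have "\<dots> = C * ((p - 1) * (a powr p / a powr p) + b powr p / b powr p)"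
      using int by (simp add: powr_p)
    also have "\<dots> = p * C"
      using ab by simp
    finally show ?thesis using p by (simp add: C_def)
  qed
qed

section \<open>Functions in the Lebesgue-Bochner space\<close>

text \<open>
  The simple functions converge only almost everywhere, so the limit is Borel measurable after a
  change on a null set; completeness of the measure undoes that change.
\<close>

lemma strongly_measurable_borel_measurable:
  assumes "complete_measure M" "strongly_measurable M f"
  shows "f \<in> borel_measurable M"
proof -
  interpret complete_measure M by fact
  obtain u where u: "\<And>i::nat. simple_function M (u i)"
    and lim: "AE s in M. (\<lambda>i. u i s) \<longlonglongrightarrow> f s"
    using assms(2) by (auto simp: strongly_measurable_def)
  obtain N where N: "\<And>s. s \<in> space M - N \<Longrightarrow> (\<lambda>i. u i s) \<longlonglongrightarrow> f s" "N \<in> null_sets M"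
    using AE_E3[OF lim] by blast
  then have [measurable]: "N \<in> sets M" by auto
  have [measurable]: "u i \<in> borel_measurable M" for i
    using u by (rule borel_measurable_simple_function)
  have outside: "(\<lambda>s. if s \<in> N then 0 else f s) \<in> borel_measurable M"
  proof (rule borel_measurable_LIMSEQ_metric)
    show "(\<lambda>s. if s \<in> N then 0 else u i s) \<in> borel_measurable M" for i by measurable
    show "(\<lambda>i. if s \<in> N then 0 else u i s) \<longlonglongrightarrow> (if s \<in> N then 0 else f s)"
      if "s \<in> space M" for s
      using N that by auto
  qed
  show ?thesis
  proof (rule measurableI)
    fix V :: "'b set" assume V: "V \<in> sets borel"
    have split: "f -` V \<inter> space M = ((\<lambda>s. if s \<in> N then 0 else f s) -` V \<inter> space M - N)
        \<union> (f -` V \<inter> space M \<inter> N)"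
      by auto
    have "f -` V \<inter> space M \<inter> N \<in> sets M"
      using complete2[of "f -` V \<inter> space M \<inter> N" N] N by auto
    then show "f -` V \<inter> space M \<in> sets M"
      using measurable_sets[OF outside V] \<open>N \<in> sets M\<close>
      by (subst split) (rule sets.Un[OF sets.Diff])
  qed auto
qed

lemma Lp_functions_borel_measurable:
  assumes "complete_measure M" "f \<in> Lp_functions M p"
  shows "f \<in> borel_measurable M"
  using assms by (auto simp: Lp_functions_def intro: strongly_measurable_borel_measurable)

lemma strongly_measurable_add:
  assumes "strongly_measurable M f" "strongly_measurable M g"
  shows "strongly_measurable M (\<lambda>s. f s + g s)"
proof -
  obtain u v where simple: "\<And>i::nat. simple_function M (u i)" "\<And>i::nat. simple_function M (v i)"
    and lim: "AE s in M. (\<lambda>i. u i s) \<longlonglongrightarrow> f s" "AE s in M. (\<lambda>i. v i s) \<longlonglongrightarrow> g s"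
    using assms by (auto simp: strongly_measurable_def)
  have "AE s in M. (\<lambda>i. u i s + v i s) \<longlonglongrightarrow> f s + g s"
    using lim by eventually_elim (rule tendsto_add)
  then show ?thesis
    unfolding strongly_measurable_def
    by (intro exI[of _ "\<lambda>i s. u i s + v i s"]) (auto intro: simple_function_compose2 simple)
qed

lemma strongly_measurable_scaleR:
  assumes "simple_function M w" "strongly_measurable M f"
  shows "strongly_measurable M (\<lambda>s. w s *\<^sub>R f s)"
proof -
  obtain u where simple: "\<And>i::nat. simple_function M (u i)"
    and lim: "AE s in M. (\<lambda>i. u i s) \<longlonglongrightarrow> f s"
    using assms by (auto simp: strongly_measurable_def)
  have "AE s in M. (\<lambda>i. w s *\<^sub>R u i s) \<longlonglongrightarrow> w s *\<^sub>R f s"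
    using lim by eventually_elim (intro tendsto_scaleR tendsto_const)
  then show ?thesis
    unfolding strongly_measurable_def
    by (intro exI[of _ "\<lambda>i s. w s *\<^sub>R u i s"])
      (auto intro: simple_function_compose2 assms(1) simple)
qed

lemma (in normed_space_over) tendsto_scale:
  assumes "(f \<longlongrightarrow> l) F"
  shows "((\<lambda>i. smul a (f i)) \<longlongrightarrow> smul a l) F"
proof -
  have "((\<lambda>i. norm a * norm (f i - l)) \<longlongrightarrow> norm a * norm (l - l)) F"
    by (intro tendsto_intros assms)
  then have "((\<lambda>i. norm (smul a (f i) - smul a l)) \<longlongrightarrow> 0) F"
    by (simp add: norm_scale flip: scale_right_diff_distrib)
  then show ?thesis
    by (rule LIM_zero_cancel[OF tendsto_norm_zero_cancel])
qed

lemma (in normed_space_over) strongly_measurable_scale: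
  assumes "strongly_measurable M f"
  shows "strongly_measurable M (\<lambda>s. smul a (f s))"
proof -
  obtain u where simple: "\<And>i::nat. simple_function M (u i)"
    and lim: "AE s in M. (\<lambda>i. u i s) \<longlonglongrightarrow> f s"
    using assms by (auto simp: strongly_measurable_def)
  have "AE s in M. (\<lambda>i. smul a (u i s)) \<longlonglongrightarrow> smul a (f s)"
    using lim by eventually_elim (rule tendsto_scale)
  then show ?thesis
    unfolding strongly_measurable_def
    by (intro exI[of _ "\<lambda>i s. smul a (u i s)"])
      (auto intro: simple_function_compose1[where g = "smul a"] simple)
qed

lemma (in normed_space_over) Lp_functions_scale:
  assumes "f \<in> Lp_functions M p"
  shows "(\<lambda>s. smul a (f s)) \<in> Lp_functions M p"
  using assms by (auto simp: Lp_functions_def norm_scale powr_mult strongly_measurable_scale)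

lemma Lp_functions_add:
  assumes "complete_measure M" "0 < p" "f \<in> Lp_functions M p" "g \<in> Lp_functions M p"
  shows "(\<lambda>s. f s + g s) \<in> Lp_functions M p"
proof -
  have sm: "strongly_measurable M (\<lambda>s. f s + g s)"
    using assms by (auto simp: Lp_functions_def strongly_measurable_add)
  note [measurable] = strongly_measurable_borel_measurable[OF assms(1) sm]
  have "integrable M (\<lambda>s. norm (f s + g s) powr p)"
  proof (rule Bochner_Integration.integrable_bound)
    show "integrable M (\<lambda>s. 2 powr p * (norm (f s) powr p + norm (g s) powr p))"
      using assms by (auto simp: Lp_functions_def)
    have "norm (f s + g s) powr p \<le> 2 powr p * (norm (f s) powr p + norm (g s) powr p)" for s
    proof -
      have "norm (f s + g s) powr p \<le> (norm (f s) + norm (g s)) powr p"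
        using assms by (intro powr_mono2 norm_triangle_ineq) auto
      also have "\<dots> \<le> 2 powr p * (norm (f s) powr p + norm (g s) powr p)"
        using assms by (intro add_powr_le) auto
      finally show ?thesis .
    qed
    then show "AE s in M. norm (norm (f s + g s) powr p)
        \<le> norm (2 powr p * (norm (f s) powr p + norm (g s) powr p))"
      by auto
  qed measurable
  with sm show ?thesis by (simp add: Lp_functions_def)
qed

lemma Lp_function_norm_powr:
  assumes "0 < p"
  shows "Lp_function_norm M p f powr p = (\<integral>s. norm (f s) powr p \<partial>M)"
proof -
  have "0 \<le> (\<integral>s. norm (f s) powr p \<partial>M)" by (auto intro!: integral_nonneg_AE)
  then show ?thesis using assms by (simp add: Lp_function_norm_def powr_powr)
qed

lemma Lp_function_norm_nonneg: "0 \<le> Lp_function_norm M p f"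
  by (simp add: Lp_function_norm_def)

lemma Lp_function_norm_mono:
  assumes "0 < p" "(\<integral>s. norm (f s) powr p \<partial>M) \<le> (\<integral>s. norm (g s) powr p \<partial>M)"
  shows "Lp_function_norm M p f \<le> Lp_function_norm M p g"
  using assms unfolding Lp_function_norm_def
  by (intro powr_mono2 integral_nonneg_AE) auto

lemma Lp_function_norm_scaleR:
  assumes "0 < p" "0 \<le> r"
  shows "Lp_function_norm M p (\<lambda>s. r *\<^sub>R f s) = r * Lp_function_norm M p f"
  using assms by (simp add: Lp_function_norm_def powr_mult powr_powr)

section \<open>The multiplication operator\<close>

definition weighted :: "'s set \<Rightarrow> real \<Rightarrow> ('s \<Rightarrow> 'x::real_normed_vector) \<Rightarrow> 's \<Rightarrow> 'x" where
  "weighted A r f = (\<lambda>s. (if s \<in> A then r else 1) *\<^sub>R f s)"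

text \<open>The image of a class under \<^const>\<open>weighted\<close> is saturated to give a class again.\<close>

definition weighted_class ::
    "'s measure \<Rightarrow> real \<Rightarrow> 's set \<Rightarrow> real \<Rightarrow> ('s \<Rightarrow> 'x::real_normed_vector) set \<Rightarrow> ('s \<Rightarrow> 'x) set" where
  "weighted_class M p A r U = Lp_eq M p `` (weighted A r ` U)"

lemma weighted_add: "weighted A r (\<lambda>s. f s + g s) = (\<lambda>s. weighted A r f s + weighted A r g s)"
  by (simp add: weighted_def scaleR_add_right)

lemma (in normed_space_over) weighted_scale:
  "weighted A r (\<lambda>s. smul a (f s)) = (\<lambda>s. smul a (weighted A r f s))"
  by (simp add: weighted_def fun_eq_iff mult.commute flip: scale_of_real)

context
  fixes M :: "'s measure" and p r c :: real and A :: "'s set"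
  assumes complete: "complete_measure M" and p: "1 < p" and A: "A \<in> sets M"
    and r: "0 \<le> r" and c: "0 \<le> c" and r_powr: "r powr p = 1 + c"
begin

lemma norm_weighted_powr:
  "norm (weighted A r f s) powr p = norm (f s) powr p + c * (indicator A s * norm (f s) powr p)"
  using p r by (simp add: weighted_def powr_mult r_powr algebra_simps)

lemma integrable_on_set:
  assumes "f \<in> Lp_functions M p"
  shows "integrable M (\<lambda>s. indicator A s * norm (f s) powr p)"
  using assms A integrable_mult_indicator[of A M "\<lambda>s. norm (f s) powr p"]
  by (simp add: Lp_functions_def)

lemma weighted_in_Lp_functions:
  assumes "f \<in> Lp_functions M p"
  shows "weighted A r f \<in> Lp_functions M p"
proof -
  have "simple_function M (\<lambda>s. if s \<in> A then r else 1)"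
    using A by (intro simple_function_If_set) (auto simp: Int_absorb1 sets.sets_into_space)
  then have "strongly_measurable M (weighted A r f)"
    using assms unfolding weighted_def
    by (intro strongly_measurable_scaleR) (auto simp: Lp_functions_def)
  moreover have "integrable M (\<lambda>s. norm (weighted A r f s) powr p)"
    using assms integrable_on_set[OF assms] unfolding norm_weighted_powr
    by (auto simp: Lp_functions_def)
  ultimately show ?thesis by (simp add: Lp_functions_def)
qed

lemma integral_weighted:
  assumes "f \<in> Lp_functions M p"
  shows "(\<integral>s. norm (weighted A r f s) powr p \<partial>M)
    = (\<integral>s. norm (f s) powr p \<partial>M) + c * (\<integral>s. indicator A s * norm (f s) powr p \<partial>M)"
  using assms integrable_on_set[OF assms] unfolding norm_weighted_powr
  by (auto simp: Lp_functions_def)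

lemma Lp_function_norm_le_weighted:
  assumes "f \<in> Lp_functions M p"
  shows "Lp_function_norm M p f \<le> Lp_function_norm M p (weighted A r f)"
proof (rule Lp_function_norm_mono)
  have "0 \<le> (\<integral>s. indicator A s * norm (f s) powr p \<partial>M)"
    by (auto intro!: integral_nonneg_AE)
  then show "(\<integral>s. norm (f s) powr p \<partial>M) \<le> (\<integral>s. norm (weighted A r f s) powr p \<partial>M)"
    using c by (simp add: integral_weighted[OF assms])
qed (use p in auto)

lemma Lp_function_norm_weighted_le:
  assumes "f \<in> Lp_functions M p"
  shows "Lp_function_norm M p (weighted A r f) \<le> r * Lp_function_norm M p f"
proof -
  have "(\<integral>s. indicator A s * norm (f s) powr p \<partial>M) \<le> (\<integral>s. norm (f s) powr p \<partial>M)"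
    using assms integrable_on_set[OF assms]
    by (intro integral_mono) (auto simp: Lp_functions_def indicator_def)
  then have "(\<integral>s. norm (weighted A r f s) powr p \<partial>M) \<le> r powr p * (\<integral>s. norm (f s) powr p \<partial>M)"
    using c by (simp add: integral_weighted[OF assms] r_powr algebra_simps mult_left_mono)
  then have "Lp_function_norm M p (weighted A r f)
      \<le> (r powr p * (\<integral>s. norm (f s) powr p \<partial>M)) powr (1 / p)"
    unfolding Lp_function_norm_def using p
    by (intro powr_mono2 integral_nonneg_AE) auto
  also have "\<dots> = r * Lp_function_norm M p f"
    using p r by (simp add: Lp_function_norm_def powr_mult powr_powr)
  finally show ?thesis .
qed

text \<open>
  The tangent inequality is integrated over \<open>A\<close>, and Hoelder's inequality is applied on the whole
  space, which only enlarges the error.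
\<close>

lemma integral_on_set_perturbed:
  assumes f: "f \<in> Lp_functions M p" and h: "h \<in> Lp_functions M p"
  shows "(\<integral>s. indicator A s * norm (f s) powr p \<partial>M)
      - p * (Lp_function_norm M p f powr (p - 1) * Lp_function_norm M p h)
    \<le> (\<integral>s. indicator A s * norm (f s + h s) powr p \<partial>M)"
proof -
  note [measurable] = Lp_functions_borel_measurable[OF complete f]
    Lp_functions_borel_measurable[OF complete h]
  have int: "integrable M (\<lambda>s. norm (f s) powr p)" "integrable M (\<lambda>s. norm (h s) powr p)"
    using f h by (auto simp: Lp_functions_def)
  have fh: "(\<lambda>s. f s + h s) \<in> Lp_functions M p"
    using complete p f h by (intro Lp_functions_add) auto
  have int_mult: "integrable M (\<lambda>s. norm (f s) powr (p - 1) * norm (h s))"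
    using p int by (intro integrable_powr_mult) auto
  have Hoelder: "(\<integral>s. norm (f s) powr (p - 1) * norm (h s) \<partial>M)
      \<le> Lp_function_norm M p f powr (p - 1) * Lp_function_norm M p h"
    unfolding Lp_function_norm_def using p int by (intro Hoelder_powr) auto
  have pointwise: "indicator A s * norm (f s) powr p - p * (norm (f s) powr (p - 1) * norm (h s))
      \<le> indicator A s * norm (f s + h s) powr p" for s
  proof (cases "s \<in> A")
    case True
    have "norm (f s) - norm (h s) \<le> norm (f s + h s)"
      by (rule norm_diff_ineq)
    then show ?thesis
      using True p powr_ge_tangent[of p "norm (f s)" "norm (f s + h s)" "norm (h s)"] by simp
  qed (use p in simp)
  have "(\<integral>s. indicator A s * norm (f s) powr p \<partial>M)
        - p * (\<integral>s. norm (f s) powr (p - 1) * norm (h s) \<partial>M)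
      = (\<integral>s. indicator A s * norm (f s) powr p - p * (norm (f s) powr (p - 1) * norm (h s)) \<partial>M)"
    using integrable_on_set[OF f] int_mult by simp
  also have "\<dots> \<le> (\<integral>s. indicator A s * norm (f s + h s) powr p \<partial>M)"
    using integrable_on_set[OF f] integrable_on_set[OF fh] int_mult pointwise
    by (intro integral_mono) auto
  finally have "(\<integral>s. indicator A s * norm (f s) powr p \<partial>M)
        - p * (\<integral>s. norm (f s) powr (p - 1) * norm (h s) \<partial>M)
      \<le> (\<integral>s. indicator A s * norm (f s + h s) powr p \<partial>M)" .
  moreover have "p * (\<integral>s. norm (f s) powr (p - 1) * norm (h s) \<partial>M)
      \<le> p * (Lp_function_norm M p f powr (p - 1) * Lp_function_norm M p h)"
    using Hoelder p by (intro mult_left_mono) auto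
  ultimately show ?thesis by linarith
qed

text \<open>
  Orthogonality enters as the hypothesis that adding \<open>h\<close> does not decrease the norm of \<open>f\<close>, so
  only the part of the weighted integral over \<open>A\<close> can decrease. The factor \<open>c p\<close> is the product of the excess weight \<open>c\<close> on \<open>A\<close> and
  the exponent from the tangent inequality. As the weight is at least \<open>1\<close>, the norms of \<open>f\<close> and
  \<open>h\<close> in the error term may be replaced by those of their images.
\<close>

lemma weighted_almost_orthogonal:
  assumes f: "f \<in> Lp_functions M p" and h: "h \<in> Lp_functions M p"
    and le: "Lp_function_norm M p f \<le> Lp_function_norm M p (\<lambda>s. f s + h s)"
  shows "Lp_function_norm M p (weighted A r f) - c * p * Lp_function_norm M p (weighted A r h)
    \<le> Lp_function_norm M p (weighted A r (\<lambda>s. f s + h s))"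
proof (rule ge_diff_if_powr_ge[OF p])
  let ?n = "Lp_function_norm M p" and ?w = "weighted A r"
  have fh: "(\<lambda>s. f s + h s) \<in> Lp_functions M p"
    using complete p f h by (intro Lp_functions_add) auto
  have "?n f powr (p - 1) * ?n h \<le> ?n (?w f) powr (p - 1) * ?n (?w h)"
    using p f h Lp_function_norm_le_weighted Lp_function_norm_nonneg
    by (intro mult_mono powr_mono2) auto
  then have err: "c * (p * (?n f powr (p - 1) * ?n h))
      \<le> c * (p * (?n (?w f) powr (p - 1) * ?n (?w h)))"
    using c p by (intro mult_left_mono) auto
  have "?n f powr p \<le> ?n (\<lambda>s. f s + h s) powr p"
    using le p Lp_function_norm_nonneg by (intro powr_mono2) auto
  then have first: "(\<integral>s. norm (f s) powr p \<partial>M) \<le> (\<integral>s. norm (f s + h s) powr p \<partial>M)"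
    using p by (simp add: Lp_function_norm_powr)
  have second: "c * ((\<integral>s. indicator A s * norm (f s) powr p \<partial>M) - p * (?n f powr (p - 1) * ?n h))
    \<le> c * (\<integral>s. indicator A s * norm (f s + h s) powr p \<partial>M)"
    using integral_on_set_perturbed[OF f h] c by (rule mult_left_mono)
  have "?n (?w f) powr p - c * (p * (?n (?w f) powr (p - 1) * ?n (?w h)))
      \<le> ?n (?w (\<lambda>s. f s + h s)) powr p"
    using first second err p
    by (simp add: Lp_function_norm_powr integral_weighted f fh right_diff_distrib)
  then show "?n (?w f) powr p - ?n (?w f) powr (p - 1) * (c * p * ?n (?w h))
      \<le> ?n (?w (\<lambda>s. f s + h s)) powr p"
    by (simp add: algebra_simps)
qed (use c p in \<open>auto intro!: mult_nonneg_nonneg Lp_function_norm_nonneg\<close>)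

lemma weighted_class_eq:
  assumes "f \<in> Lp_functions M p"
  shows "weighted_class M p A r (Lp_eq M p `` {f}) = Lp_eq M p `` {weighted A r f}"
proof -
  have rel: "(weighted A r f, weighted A r g) \<in> Lp_eq M p" if "(f, g) \<in> Lp_eq M p" for g
  proof -
    have "AE s in M. f s = g s"
      using that by (simp add: Lp_eq_def)
    then have "AE s in M. weighted A r f s = weighted A r g s"
      by eventually_elim (simp add: weighted_def)
    then show ?thesis
      using that by (simp add: Lp_eq_def weighted_in_Lp_functions)
  qed
  have "(f, f) \<in> Lp_eq M p"
    using assms by (simp add: Lp_eq_def)
  moreover have "Lp_eq M p `` {weighted A r g} = Lp_eq M p `` {weighted A r f}"
    if "(f, g) \<in> Lp_eq M p" for g
    using equiv_class_eq[OF equiv_Lp_eq rel[OF that]] by simp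
  ultimately show ?thesis
    unfolding weighted_class_def by blast
qed

end

section \<open>Failure of Property P\<close>

lemma Lp_space_points_cases:
  assumes "U \<in> points (Lp_space smul M p)"
  obtains f where "f \<in> Lp_functions M p" "U = Lp_eq M p `` {f}"
  using assms by (auto simp: Lp_space_def elim: quotientE)

lemma Lp_space_points_class:
  "f \<in> Lp_functions M p \<Longrightarrow> Lp_eq M p `` {f} \<in> points (Lp_space smul M p)"
  by (simp add: Lp_space_def quotientI)

lemma indicator_in_Lp_functions:
  assumes "A \<in> sets M" "emeasure M A < \<infinity>"
  shows "(\<lambda>s. indicator A s *\<^sub>R x) \<in> Lp_functions M p"
proof -
  have "simple_function M (\<lambda>s. indicator A s *\<^sub>R x)"
    using assms by (intro simple_function_compose1[of _ _ "\<lambda>t. t *\<^sub>R x"] simple_function_indicator)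
  then have "strongly_measurable M (\<lambda>s. indicator A s *\<^sub>R x)"
    unfolding strongly_measurable_def by (intro exI[of _ "\<lambda>_ s. indicator A s *\<^sub>R x"]) auto
  moreover have "(\<lambda>s. norm (indicator A s *\<^sub>R x) powr p)
      = (\<lambda>s. indicator A s * norm x powr p)"
    by (auto simp: indicator_def)
  ultimately show ?thesis
    using assms by (simp add: Lp_functions_def)
qed

lemma Lp_function_norm_indicator_pos:
  assumes "A \<in> sets M" "0 < emeasure M A" "emeasure M A < \<infinity>" "x \<noteq> 0"
  shows "0 < Lp_function_norm M p (\<lambda>s. indicator A s *\<^sub>R x)"
proof -
  have "0 < measure M A"
    using assms by (simp add: measure_def enn2real_positive_iff)
  moreover have "(\<lambda>s. norm (indicator A s *\<^sub>R x) powr p) = (\<lambda>s. indicator A s * norm x powr p)"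
    by (auto simp: indicator_def)
  ultimately show ?thesis
    using assms by (simp add: Lp_function_norm_def)
qed

lemma (in normed_space_over) not_property_P_Lp_space:
  fixes M :: "'s measure" and p :: real
  assumes M: "complete_measure M" and p: "1 < p"
    and A: "A \<in> sets M" "0 < emeasure M A" "emeasure M A < \<infinity>"
    and B: "B \<in> sets M" "0 < emeasure M B" "emeasure M B < \<infinity>"
    and disj: "A \<inter> B = {}" and x: "(x :: 'x) \<noteq> 0"
  shows "\<not> property_P (Lp_space smul M p)"
proof
  let ?L = "Lp_space smul M p" and ?cl = "\<lambda>f. Lp_eq M p `` {f}" and ?n = "Lp_function_norm M p"
  assume "property_P ?L"
  then obtain \<epsilon> where \<epsilon>: "0 < \<epsilon>" and P: "\<forall>T\<in>bounded_operators ?L.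
      (\<forall>U\<in>points ?L. \<forall>V\<in>points ?L. BJ_orthogonal ?L U V \<longrightarrow>
         approx_BJ_orthogonal ?L \<epsilon> (T U) (T V)) \<longrightarrow>
      (\<exists>k\<ge>0. \<forall>U\<in>points ?L. vnorm ?L (T U) = k * vnorm ?L U)"
    unfolding property_P_def by (elim exE conjE)
  \<comment> \<open>This makes the loss \<open>c p \<parallel>w h\<parallel>\<close> of the weighted norm equal to \<open>\<epsilon> \<parallel>w h\<parallel>\<close>.\<close>
  define c where "c = \<epsilon> / p"
  define r where "r = (1 + c) powr (1 / p)"
  have c: "0 < c" "c * p = \<epsilon>" using \<epsilon> p by (auto simp: c_def)
  have r: "0 \<le> r" "r powr p = 1 + c" using c p by (auto simp: r_def powr_powr)
  have r1: "r \<noteq> 1" using r c by auto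
  let ?w = "weighted A r :: ('s \<Rightarrow> 'x) \<Rightarrow> 's \<Rightarrow> 'x"
  let ?T = "weighted_class M p A r :: ('s \<Rightarrow> 'x) set \<Rightarrow> ('s \<Rightarrow> 'x) set"
  note hyps = M p A(1) r(1) less_imp_le[OF c(1)] r(2)
  note w_Lp = weighted_in_Lp_functions[OF hyps]
  note T_eq = weighted_class_eq[OF hyps]
  have p0: "0 < p" using p by simp
  note add_Lp = Lp_functions_add[OF M p0]
  have T_bounded: "?T \<in> bounded_operators ?L"
    unfolding bounded_operators_def mem_Collect_eq
  proof (intro conjI ballI allI)
    fix U assume "U \<in> points ?L"
    then show "?T U \<in> points ?L"
      by (elim Lp_space_points_cases) (simp add: T_eq w_Lp Lp_space_points_class)
  next
    fix U V assume "U \<in> points ?L" "V \<in> points ?L"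
    then show "?T (vadd ?L U V) = vadd ?L (?T U) (?T V)"
      by (elim Lp_space_points_cases) (simp add: T_eq w_Lp add_Lp Lp_space_vadd weighted_add)
  next
    fix a U assume "U \<in> points ?L"
    then show "?T (vscale ?L a U) = vscale ?L a (?T U)"
      by (elim Lp_space_points_cases)
        (simp add: T_eq w_Lp Lp_functions_scale Lp_space_vscale weighted_scale)
  next
    show "\<exists>K. \<forall>U\<in>points ?L. vnorm ?L (?T U) \<le> K * vnorm ?L U"
      by (intro exI[of _ r] ballI, elim Lp_space_points_cases)
        (simp add: T_eq w_Lp Lp_space_vnorm Lp_function_norm_weighted_le[OF hyps])
  qed
  have T_orth: "approx_BJ_orthogonal ?L \<epsilon> (?T U) (?T V)"
    if U: "U \<in> points ?L" and V: "V \<in> points ?L" and orth: "BJ_orthogonal ?L U V" for U V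
  proof -
    obtain f where f: "f \<in> Lp_functions M p" "U = ?cl f" using U by (rule Lp_space_points_cases)
    obtain g where g: "g \<in> Lp_functions M p" "V = ?cl g" using V by (rule Lp_space_points_cases)
    note scale_Lp = Lp_functions_scale[OF g(1)]
    have "(?n (?w f))\<^sup>2 - 2 * \<epsilon> * ?n (?w f) * ?n (?w (\<lambda>s. smul a (g s)))
        \<le> (?n (?w (\<lambda>s. f s + smul a (g s))))\<^sup>2" for a
    proof -
      have "vnorm ?L U \<le> vnorm ?L (vadd ?L U (vscale ?L a V))"
        using orth by (auto simp: BJ_orthogonal_def)
      then have "?n f \<le> ?n (\<lambda>s. f s + smul a (g s))"
        by (simp add: f g Lp_space_vnorm Lp_space_vadd Lp_space_vscale scale_Lp add_Lp)
      from weighted_almost_orthogonal[OF hyps f(1) scale_Lp this]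
      have "?n (?w f) - \<epsilon> * ?n (?w (\<lambda>s. smul a (g s))) \<le> ?n (?w (\<lambda>s. f s + smul a (g s)))"
        by (simp add: c(2))
      from square_ge_if_ge_diff[OF Lp_function_norm_nonneg _ this] show ?thesis
        using \<epsilon> by (simp add: Lp_function_norm_nonneg mult.assoc mult.left_commute)
    qed
    then show ?thesis
      unfolding approx_BJ_orthogonal_def
      by (simp add: f g T_eq w_Lp scale_Lp add_Lp Lp_space_vnorm Lp_space_vadd Lp_space_vscale
          flip: weighted_add weighted_scale)
  qed
  obtain k where T_norm: "\<And>U. U \<in> points ?L \<Longrightarrow> vnorm ?L (?T U) = k * vnorm ?L U"
    using bspec[OF P T_bounded] T_orth by blast
  have k: "?n (?w f) = k * ?n f" if f: "f \<in> Lp_functions M p" for f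
    using T_norm[OF Lp_space_points_class[OF f]] by (simp add: T_eq w_Lp Lp_space_vnorm f)
  let ?f = "\<lambda>s. indicator A s *\<^sub>R x" and ?g = "\<lambda>s. indicator B s *\<^sub>R x"
  have "?w ?f = (\<lambda>s. r *\<^sub>R ?f s)"
    by (auto simp: weighted_def indicator_def)
  then have "?n (?w ?f) = r * ?n ?f"
    using Lp_function_norm_scaleR[OF p0 r(1), of M ?f] by simp
  moreover have "?w ?g = ?g"
    using disj by (auto simp: weighted_def indicator_def fun_eq_iff)
  ultimately have "r * ?n ?f = k * ?n ?f" "?n ?g = k * ?n ?g"
    using k[OF indicator_in_Lp_functions[OF A(1,3)], of x]
      k[OF indicator_in_Lp_functions[OF B(1,3)], of x] by auto
  then have "r = k" "k = 1"
    using Lp_function_norm_indicator_pos[OF A x, of p]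
      Lp_function_norm_indicator_pos[OF B x, of p] by auto
  with r1 show False by simp
qed

lemma normed_space_over_scaleR:
  "normed_space_over ((*\<^sub>R) :: real \<Rightarrow> 'x::real_normed_vector \<Rightarrow> 'x)"
  by unfold_locales (auto simp: scaleR_add_right scaleR_add_left)

theorem theorem3p6:
  fixes M :: "'s measure" and p :: real
  assumes "complete_measure M"
    and "\<exists>A\<in>sets M. \<exists>B\<in>sets M. A \<inter> B = {} \<and>
           0 < emeasure M A \<and> emeasure M A < \<infinity> \<and> 0 < emeasure M B \<and> emeasure M B < \<infinity>"
    and "\<exists>x::'x::banach. x \<noteq> 0"
    and "1 < p"
  shows "(frechet_differentiable_norm ((*\<^sub>R) :: real \<Rightarrow> 'x \<Rightarrow> 'x) id \<longrightarrow>
            \<not> property_P (Lp_space ((*\<^sub>R) :: real \<Rightarrow> 'x \<Rightarrow> 'x) M p))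
       \<and> (\<forall>scaleC :: complex \<Rightarrow> 'x \<Rightarrow> 'x.
            normed_space_over scaleC \<and> frechet_differentiable_norm scaleC Re \<longrightarrow>
            \<not> property_P (Lp_space scaleC M p))"
proof -
  obtain A B where A: "A \<in> sets M" "0 < emeasure M A" "emeasure M A < \<infinity>"
    and B: "B \<in> sets M" "0 < emeasure M B" "emeasure M B < \<infinity>" and disj: "A \<inter> B = {}"
    using assms(2) by blast
  obtain x :: 'x where x: "x \<noteq> 0" using assms(3) by blast
  note not_P = normed_space_over.not_property_P_Lp_space[OF _ assms(1,4) A B disj x]
  show ?thesis
    by (intro conjI allI impI; (elim conjE)?; intro not_P normed_space_over_scaleR)
qed

end
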